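(* Let $G$ be a group and let $A$ be a non-empty set. For $T\in \mathrm{CA}(G,A)$ define $f_T:A^G\to A$ by $f_T(x)=T(x)(1)$, where $1$ is the identity of $G$. Then the map $T\mapsto f_T$ is an isomorphism between the monoids $(\mathrm{CA}(G,A),\circ,\mathrm{id}_{A^G})$ and $(\mathcal{U}(A^G,A),\ast,p_1)$.
   Context: $A^G$ is the set of all maps (configurations) $x:G\to A$. The group $G$ acts on $A^G$ by shift: $(g\cdot x)(h)=x(g^{-1}h)$ for $g,h\in G$, $x\in A^G$. A cellular automaton over $G$ with alphabet $A$ is a map $T:A^G\to A^G$ for which there exist a finite subset $S\subseteq G$ (called a memory set) and a function $\mu:A^S\to A$ (called a local defining function) such that $T(x)(g)=\mu((g^{-1}\cdot x)|_S)$ for all $x\in A^G$ and $g\in G$, where $|_S$ denotes restriction to $S$. $\mathrm{CA}(G,A)$ denotes the set of all such cellular automata; it is a monoid under composition of maps. $A$ carries the discrete uniform structure and $A^G$ carries the pro-discrete uniform structure (the product of the discrete uniform structures), a basis of which is given by the sets $W_\Omega=\{(x,y)\in A^G\times A^G: x|_\Omega=y|_\Omega\}$ for $\Omega\subseteq G$ finite. $\mathcal{U}(A^G,A)$ denotes the set of all uniformly continuous functions $A^G\to A$. It is equipped with the binary operation $\ast$ defined by $$(f_1\ast f_2)(x)=f_1\big((f_2(g^{-1}\cdot x))_{g\in G}\big),$$ where $(f_2(g^{-1}\cdot x))_{g\in G}\in A^G$ is the configuration $g\mapsto f_2(g^{-1}\cdot x)$. The map $p_1:A^G\to A$ is the projection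 $p_1(x)=x(1)$. That $\mathcal{U}(A^G,A)$ is a monoid under $\ast$ with identity $p_1$ is part of what the theorem asserts. *)

theory Defs
  imports Complex_Main "HOL-Algebra.Group"
begin

section \<open>Configurations and cellular automata\<close>

text \<open>
  The group and the alphabet are given by carrier sets, and all function spaces between sets are
  extensional (\<^const>\<open>PiE\<close>), so that equality of elements is equality of maps on the stated domain.
\<close>

definition configs :: "('g, 'm) monoid_scheme \<Rightarrow> 'a set \<Rightarrow> ('g \<Rightarrow> 'a) set" where
  "configs G A = carrier G \<rightarrow>\<^sub>E A"

definition shift :: "('g, 'm) monoid_scheme \<Rightarrow> 'g \<Rightarrow> ('g \<Rightarrow> 'a) \<Rightarrow> ('g \<Rightarrow> 'a)" where
  "shift G g x = (\<lambda>h\<in>carrier G. x (inv\<^bsub>G\<^esub> g \<otimes>\<^bsub>G\<^esub> h))"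

definition cellular_automata ::
  "('g, 'm) monoid_scheme \<Rightarrow> 'a set \<Rightarrow> (('g \<Rightarrow> 'a) \<Rightarrow> ('g \<Rightarrow> 'a)) set" where
  "cellular_automata G A = {T \<in> configs G A \<rightarrow>\<^sub>E configs G A.
     \<exists>S \<mu>. finite S \<and> S \<subseteq> carrier G \<and> \<mu> \<in> (S \<rightarrow>\<^sub>E A) \<rightarrow> A \<and>
       (\<forall>x\<in>configs G A. \<forall>g\<in>carrier G. T x g = \<mu> (restrict (shift G (inv\<^bsub>G\<^esub> g) x) S))}"

definition CA_monoid ::
  "('g, 'm) monoid_scheme \<Rightarrow> 'a set \<Rightarrow> (('g \<Rightarrow> 'a) \<Rightarrow> ('g \<Rightarrow> 'a)) monoid" where
  "CA_monoid G A =
     \<lparr>carrier = cellular_automata G A,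
      mult = compose (configs G A),
      one = (\<lambda>x\<in>configs G A. x)\<rparr>"


section \<open>Uniform structures and uniformly continuous functions\<close>

text \<open>
  The library's class \<^class>\<open>uniform_space\<close> attaches a single uniformity to a whole type, and its
  instance for function types needs a countable index type and metric values. Here a uniform
  structure on a set \<open>X\<close> is the filter of its entourages, a filter on pairs that
  contains \<open>X \<times> X\<close>. Uniform continuity is the same limit condition as in
  \<^const>\<open>uniformly_continuous_on\<close>, relative to explicitly given uniformities.
\<close>

definition discrete_uniformity :: "'a set \<Rightarrow> ('a \<times> 'a) filter" where
  "discrete_uniformity A = principal (Id_on A)"

text \<open>The coarsest uniform structure on \<open>\<Pi>\<^sub>E i\<in>I. X i\<close> making every coordinate uniformly continuous.\<close>

definition product_uniformity ::
  "'i set \<Rightarrow> ('i \<Rightarrow> 'a set) \<Rightarrow> ('i \<Rightarrow> ('a \<times> 'a) filter) \<Rightarrow> (('i \<Rightarrow> 'a) \<times> ('i \<Rightarrow> 'a)) filter" where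
  "product_uniformity I X U =
     inf (INF i\<in>I. filtercomap (\<lambda>(x, y). (x i, y i)) (U i)) (principal (Pi\<^sub>E I X \<times> Pi\<^sub>E I X))"

definition prodiscrete_uniformity ::
  "('g, 'm) monoid_scheme \<Rightarrow> 'a set \<Rightarrow> (('g \<Rightarrow> 'a) \<times> ('g \<Rightarrow> 'a)) filter" where
  "prodiscrete_uniformity G A =
     product_uniformity (carrier G) (\<lambda>_. A) (\<lambda>_. discrete_uniformity A)"

definition uniformly_continuous_wrt ::
  "('a \<times> 'a) filter \<Rightarrow> ('b \<times> 'b) filter \<Rightarrow> ('a \<Rightarrow> 'b) \<Rightarrow> bool" where
  "uniformly_continuous_wrt U V f \<longleftrightarrow> filterlim (\<lambda>(x, y). (f x, f y)) V U"

lemma eventually_prodiscrete_uniformity: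
  fixes G :: "('g, 'm) monoid_scheme" and A :: "'a set"
  shows "eventually P (prodiscrete_uniformity G A) \<longleftrightarrow>
     (\<exists>\<Omega>. finite \<Omega> \<and> \<Omega> \<subseteq> carrier G \<and>
        (\<forall>x\<in>configs G A. \<forall>y\<in>configs G A. restrict x \<Omega> = restrict y \<Omega> \<longrightarrow> P (x, y)))"
proof -
  define F where "F = (\<lambda>g::'g. filtercomap (\<lambda>(x::'g \<Rightarrow> 'a, y). (x g, y g)) (discrete_uniformity A))"
  have F: "F g = principal {(x, y). x g = y g \<and> x g \<in> A}" for g
    unfolding F_def discrete_uniformity_def filtercomap_principal
    by (rule arg_cong[where f = principal]) (auto simp: Id_on_def)
  have fin: "(INF g\<in>\<Omega>. F g) = principal {(x, y). \<forall>g\<in>\<Omega>. x g = y g \<and> x g \<in> A}"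
    if "finite \<Omega>" for \<Omega>
    using that by (induction \<Omega>) (auto simp: F intro!: arg_cong[where f = principal])
  have res: "restrict x \<Omega> = restrict y \<Omega> \<longleftrightarrow> (\<forall>g\<in>\<Omega>. x g = y g)" for x y :: "'g \<Rightarrow> 'a" and \<Omega>
    by (metis restrict_apply' restrict_ext)
  have "eventually P (prodiscrete_uniformity G A) \<longleftrightarrow>
      eventually (\<lambda>z. z \<in> configs G A \<times> configs G A \<longrightarrow> P z) (INF g\<in>carrier G. F g)"
    unfolding prodiscrete_uniformity_def product_uniformity_def eventually_inf_principal
      F_def configs_def ..
  also have "\<dots> \<longleftrightarrow> (\<exists>\<Omega>. finite \<Omega> \<and> \<Omega> \<subseteq> carrier G \<and>
      eventually (\<lambda>z. z \<in> configs G A \<times> configs G A \<longrightarrow> P z) (INF g\<in>\<Omega>. F g))"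
    by (subst eventually_INF) auto
  also have "\<dots> \<longleftrightarrow> (\<exists>\<Omega>. finite \<Omega> \<and> \<Omega> \<subseteq> carrier G \<and>
      (\<forall>x\<in>configs G A. \<forall>y\<in>configs G A. restrict x \<Omega> = restrict y \<Omega> \<longrightarrow> P (x, y)))"
  proof (intro ex_cong1 conj_cong refl)
    fix \<Omega> assume \<Omega>: "finite \<Omega>" "\<Omega> \<subseteq> carrier G"
    then have "x g \<in> A" if "x \<in> configs G A" "g \<in> \<Omega>" for x g
      using that by (auto simp: configs_def PiE_def Pi_def)
    then show "eventually (\<lambda>z. z \<in> configs G A \<times> configs G A \<longrightarrow> P z) (INF g\<in>\<Omega>. F g) \<longleftrightarrow>
      (\<forall>x\<in>configs G A. \<forall>y\<in>configs G A. restrict x \<Omega> = restrict y \<Omega> \<longrightarrow> P (x, y))"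
      unfolding fin[OF \<Omega>(1)] eventually_principal res by (auto simp: Ball_def)
  qed
  finally show ?thesis .
qed

definition UC_functions :: "('g, 'm) monoid_scheme \<Rightarrow> 'a set \<Rightarrow> (('g \<Rightarrow> 'a) \<Rightarrow> 'a) set" where
  "UC_functions G A = {f \<in> configs G A \<rightarrow>\<^sub>E A.
     uniformly_continuous_wrt (prodiscrete_uniformity G A) (discrete_uniformity A) f}"

definition UC_mult ::
  "('g, 'm) monoid_scheme \<Rightarrow> 'a set \<Rightarrow>
     (('g \<Rightarrow> 'a) \<Rightarrow> 'a) \<Rightarrow> (('g \<Rightarrow> 'a) \<Rightarrow> 'a) \<Rightarrow> (('g \<Rightarrow> 'a) \<Rightarrow> 'a)" where
  "UC_mult G A f1 f2 =
     (\<lambda>x\<in>configs G A. f1 (\<lambda>g\<in>carrier G. f2 (shift G (inv\<^bsub>G\<^esub> g) x)))"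

definition UC_monoid :: "('g, 'm) monoid_scheme \<Rightarrow> 'a set \<Rightarrow> (('g \<Rightarrow> 'a) \<Rightarrow> 'a) monoid" where
  "UC_monoid G A =
     \<lparr>carrier = UC_functions G A,
      mult = UC_mult G A,
      one = (\<lambda>x\<in>configs G A. x \<one>\<^bsub>G\<^esub>)\<rparr>"

definition value_at_one ::
  "('g, 'm) monoid_scheme \<Rightarrow> 'a set \<Rightarrow> (('g \<Rightarrow> 'a) \<Rightarrow> ('g \<Rightarrow> 'a)) \<Rightarrow> (('g \<Rightarrow> 'a) \<Rightarrow> 'a)" where
  "value_at_one G A T = (\<lambda>x\<in>configs G A. T x \<one>\<^bsub>G\<^esub>)"

end

theory Submission
  imports Defs
begin

text \<open>
  A cellular automaton \<open>T\<close> commutes with the shift, so it is determined by its values at the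
  identity: \<open>T x g = f (g\<^sup>-\<^sup>1 \<cdot> x)\<close> with \<open>f = value_at_one G A T\<close>.
  For any \<open>f : A\<^sup>G \<rightarrow> A\<close>, let \<open>orbit_map f\<close> be the map sending \<open>x\<close> to the configuration
  \<open>g \<mapsto> f (g\<^sup>-\<^sup>1 \<cdot> x)\<close>. Uniform continuity of \<open>f\<close> says that \<open>f x\<close> depends only on the restriction
  of \<open>x\<close> to some fixed finite set (\<open>UC_functions_iff\<close>), and such a set is a memory set for
  \<open>orbit_map f\<close>. Hence \<open>value_at_one\<close> and \<open>orbit_map\<close> are mutually inverse bijections between
  cellular automata and uniformly continuous functions.

  The product of \<open>f\<^sub>1\<close> and \<open>f\<^sub>2\<close> is \<open>f\<^sub>1\<close> composed with \<open>orbit_map f\<^sub>2\<close>, so equivariance of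
  \<open>orbit_map f\<^sub>2\<close> turns the product into the composite of the orbit maps (\<open>orbit_map_UC_mult\<close>).
  If \<open>\<Omega>\<^sub>1\<close> and \<open>\<Omega>\<^sub>2\<close> are finite sets on which \<open>f\<^sub>1\<close> and \<open>f\<^sub>2\<close> depend, the product depends only on
  the finite set \<open>\<Omega>\<^sub>1\<Omega>\<^sub>2\<close>. Thus the uniformly continuous functions are closed under the product, the
  cellular automata are closed under composition, and the monoid laws for the product are those of
  composition, carried over along the bijection.
\<close>

section \<open>Uniform continuity as dependence on finitely many coordinates\<close>

lemma UC_functions_iff:
  "f \<in> UC_functions G A \<longleftrightarrow> f \<in> configs G A \<rightarrow>\<^sub>E A \<and>
     (\<exists>\<Omega>. finite \<Omega> \<and> \<Omega> \<subseteq> carrier G \<and>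
        (\<forall>x\<in>configs G A. \<forall>y\<in>configs G A. restrict x \<Omega> = restrict y \<Omega> \<longrightarrow> f x = f y))"
proof (cases "f \<in> configs G A \<rightarrow>\<^sub>E A")
  case True
  then have "(f x, f y) \<in> Id_on A \<longleftrightarrow> f x = f y"
    if "x \<in> configs G A" "y \<in> configs G A" for x y
    using PiE_mem[OF True that(1)] PiE_mem[OF True that(2)] by (auto simp: Id_on_iff)
  with True show ?thesis
    unfolding UC_functions_def uniformly_continuous_wrt_def discrete_uniformity_def
      filterlim_principal eventually_prodiscrete_uniformity
    by simp
next
  case False
  then show ?thesis by (simp add: UC_functions_def)
qed

lemma UC_functionsI:
  assumes "f \<in> configs G A \<rightarrow>\<^sub>E A" "finite \<Omega>" "\<Omega> \<subseteq> carrier G"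
    and "\<And>x y. \<lbrakk>x \<in> configs G A; y \<in> configs G A; restrict x \<Omega> = restrict y \<Omega>\<rbrakk> \<Longrightarrow> f x = f y"
  shows "f \<in> UC_functions G A"
  unfolding UC_functions_iff by (intro conjI exI ballI impI) (fact assms)+

lemma UC_functionsE:
  assumes "f \<in> UC_functions G A"
  obtains \<Omega> where "finite \<Omega>" "\<Omega> \<subseteq> carrier G"
    "\<And>x y. \<lbrakk>x \<in> configs G A; y \<in> configs G A; restrict x \<Omega> = restrict y \<Omega>\<rbrakk> \<Longrightarrow> f x = f y"
proof -
  obtain \<Omega> where \<Omega>: "finite \<Omega>" "\<Omega> \<subseteq> carrier G"
    and dep: "\<forall>x\<in>configs G A. \<forall>y\<in>configs G A. restrict x \<Omega> = restrict y \<Omega> \<longrightarrow> f x = f y"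
    using assms unfolding UC_functions_iff by (elim conjE exE)
  show thesis by (rule that[OF \<Omega> dep[rule_format]])
qed

lemma UC_functions_PiE: "f \<in> UC_functions G A \<Longrightarrow> f \<in> configs G A \<rightarrow>\<^sub>E A"
  by (simp add: UC_functions_def)

lemma CA_PiE: "T \<in> cellular_automata G A \<Longrightarrow> T \<in> configs G A \<rightarrow>\<^sub>E configs G A"
  by (simp add: cellular_automata_def)

lemma restrict_eq_iff: "restrict x S = restrict y S \<longleftrightarrow> (\<forall>s\<in>S. x s = y s)"
  by (metis restrict_apply' restrict_ext)


section \<open>The shift action\<close>

context group
begin

lemma shift_in_configs:
  "\<lbrakk>x \<in> configs G A; g \<in> carrier G\<rbrakk> \<Longrightarrow> shift G g x \<in> configs G A"
  by (auto simp: configs_def shift_def)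

lemma shift_one: "x \<in> configs G A \<Longrightarrow> shift G \<one> x = x"
  by (auto simp: configs_def shift_def PiE_iff extensional_def)

lemma shift_shift:
  "\<lbrakk>g \<in> carrier G; h \<in> carrier G\<rbrakk> \<Longrightarrow> shift G g (shift G h x) = shift G (g \<otimes> h) x"
  by (auto simp: shift_def inv_mult_group m_assoc)

lemma shift_inv_apply:
  "\<lbrakk>g \<in> carrier G; h \<in> carrier G\<rbrakk> \<Longrightarrow> shift G (inv g) x h = x (g \<otimes> h)"
  by (simp add: shift_def)


section \<open>The equivariant map induced by a function on configurations\<close>

text \<open>
  The map \<open>A\<^sup>G \<rightarrow> A\<^sup>G\<close> that evaluates \<open>f\<close> along the shift orbit of a configuration. It is the only
  equivariant map whose value at the identity is \<open>f\<close>.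
\<close>
definition orbit_map :: "'c set \<Rightarrow> (('a \<Rightarrow> 'c) \<Rightarrow> 'c) \<Rightarrow> (('a \<Rightarrow> 'c) \<Rightarrow> ('a \<Rightarrow> 'c))" where
  "orbit_map A f = (\<lambda>x\<in>configs G A. \<lambda>g\<in>carrier G. f (shift G (inv g) x))"

lemma orbit_map_apply:
  "\<lbrakk>x \<in> configs G A; g \<in> carrier G\<rbrakk> \<Longrightarrow> orbit_map A f x g = f (shift G (inv g) x)"
  by (simp add: orbit_map_def)

lemma orbit_map_in_configs:
  assumes "f \<in> configs G A \<rightarrow> A" "x \<in> configs G A"
  shows "orbit_map A f x \<in> configs G A"
proof -
  have "f (shift G (inv g) x) \<in> A" if "g \<in> carrier G" for g
    using that by (intro Pi_mem[OF assms(1)] shift_in_configs[OF assms(2)] inv_closed)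
  then show ?thesis
    unfolding orbit_map_def restrict_apply'[OF assms(2)] by (simp add: configs_def)
qed

lemma orbit_map_shift:
  assumes "x \<in> configs G A" "g \<in> carrier G"
  shows "orbit_map A f (shift G g x) = shift G g (orbit_map A f x)"
proof -
  have "orbit_map A f (shift G g x) h = orbit_map A f x (inv g \<otimes> h)" if h: "h \<in> carrier G" for h
  proof -
    have "shift G (inv h) (shift G g x) = shift G (inv (inv g \<otimes> h)) x"
      using assms(2) h by (simp add: shift_shift inv_mult_group)
    then show ?thesis
      using assms h by (simp add: orbit_map_apply shift_in_configs)
  qed
  moreover have "orbit_map A f (shift G g x) \<in> extensional (carrier G)"
    using assms by (simp add: orbit_map_def shift_in_configs)
  ultimately show ?thesis
    by (intro extensionalityI[of _ "carrier G"]) (simp_all add: shift_def)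
qed

lemma UC_mult_apply:
  "x \<in> configs G A \<Longrightarrow> UC_mult G A f1 f2 x = f1 (orbit_map A f2 x)"
  by (simp add: UC_mult_def orbit_map_def)

lemma orbit_map_UC_mult:
  assumes "f2 \<in> configs G A \<rightarrow> A"
  shows "orbit_map A (UC_mult G A f1 f2) = compose (configs G A) (orbit_map A f1) (orbit_map A f2)"
proof
  fix x
  show "orbit_map A (UC_mult G A f1 f2) x =
      compose (configs G A) (orbit_map A f1) (orbit_map A f2) x"
  proof (cases "x \<in> configs G A")
    case True
    then have "orbit_map A (UC_mult G A f1 f2) x =
        (\<lambda>g\<in>carrier G. f1 (shift G (inv g) (orbit_map A f2 x)))"
      unfolding orbit_map_def[of A "UC_mult G A f1 f2"]
      by (auto simp: UC_mult_apply shift_in_configs orbit_map_shift)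
    also have "\<dots> = orbit_map A f1 (orbit_map A f2 x)"
      using orbit_map_in_configs[OF assms True] by (simp add: orbit_map_def[of A f1])
    finally show ?thesis
      using True by (simp add: compose_def)
  next
    case False
    then show ?thesis by (simp add: orbit_map_def compose_def)
  qed
qed

lemma value_at_one_orbit_map:
  assumes "f \<in> configs G A \<rightarrow>\<^sub>E A"
  shows "value_at_one G A (orbit_map A f) = f"
proof
  fix x
  show "value_at_one G A (orbit_map A f) x = f x"
    using assms
    by (cases "x \<in> configs G A") (auto simp: value_at_one_def orbit_map_apply shift_one)
qed


section \<open>Cellular automata correspond to uniformly continuous functions\<close>

lemma orbit_map_in_CA:
  assumes "f \<in> UC_functions G A" "A \<noteq> {}"
  shows "orbit_map A f \<in> cellular_automata G A"
proof -
  obtain \<Omega> where \<Omega>: "finite \<Omega>" "\<Omega> \<subseteq> carrier G"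
    and dep: "\<And>x y. \<lbrakk>x \<in> configs G A; y \<in> configs G A; restrict x \<Omega> = restrict y \<Omega>\<rbrakk> \<Longrightarrow> f x = f y"
    using UC_functionsE[OF assms(1)] by blast
  note f = UC_functions_PiE[OF assms(1)]
  obtain a where a: "a \<in> A" using assms(2) by blast
  \<comment> \<open>The local rule extends a pattern on \<open>\<Omega>\<close> by the constant \<open>a\<close> and applies \<open>f\<close>.\<close>
  define ext where "ext p = (\<lambda>h\<in>carrier G. if h \<in> \<Omega> then p h else a)" for p
  have ext: "ext p \<in> configs G A" if "p \<in> \<Omega> \<rightarrow> A" for p
    using that a by (auto simp: ext_def configs_def)
  have pattern: "restrict x \<Omega> \<in> \<Omega> \<rightarrow> A" if "x \<in> configs G A" for x
    using that \<Omega>(2) by (auto simp: configs_def)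
  have rule: "f (ext (restrict x \<Omega>)) = f x" if x: "x \<in> configs G A" for x
  proof (rule dep[OF ext[OF pattern[OF x]] x])
    show "restrict (ext (restrict x \<Omega>)) \<Omega> = restrict x \<Omega>"
      unfolding restrict_eq_iff ext_def using \<Omega>(2) by auto
  qed
  have "(\<lambda>p. f (ext p)) \<in> (\<Omega> \<rightarrow>\<^sub>E A) \<rightarrow> A"
    using f ext by (auto simp: PiE_iff)
  moreover have "orbit_map A f x g = f (ext (restrict (shift G (inv g) x) \<Omega>))"
    if "x \<in> configs G A" "g \<in> carrier G" for x g
    using that by (simp add: orbit_map_apply rule shift_in_configs)
  moreover have "orbit_map A f \<in> configs G A \<rightarrow>\<^sub>E configs G A"
  proof (rule PiE_I)
    show "orbit_map A f x \<in> configs G A" if "x \<in> configs G A" for x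
      using that f by (auto intro: orbit_map_in_configs)
  qed (simp add: orbit_map_def)
  ultimately show ?thesis
    unfolding cellular_automata_def using \<Omega> by blast
qed

lemma value_at_one_in_UC:
  assumes "T \<in> cellular_automata G A"
  shows "value_at_one G A T \<in> UC_functions G A"
proof -
  obtain S \<mu> where S: "finite S" "S \<subseteq> carrier G"
    and T: "\<And>x g. \<lbrakk>x \<in> configs G A; g \<in> carrier G\<rbrakk>
      \<Longrightarrow> T x g = \<mu> (restrict (shift G (inv g) x) S)"
    using assms unfolding cellular_automata_def by blast
  have "T x \<one> \<in> A" if "x \<in> configs G A" for x
    using CA_PiE[OF assms] that unfolding configs_def by blast
  then have "value_at_one G A T \<in> configs G A \<rightarrow>\<^sub>E A"
    by (simp add: value_at_one_def)
  then show ?thesis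
  proof (rule UC_functionsI[OF _ S])
    show "value_at_one G A T x = value_at_one G A T y"
      if "x \<in> configs G A" "y \<in> configs G A" "restrict x S = restrict y S" for x y
      using that by (simp add: value_at_one_def T shift_one)
  qed
qed

lemma orbit_map_value_at_one:
  assumes "T \<in> cellular_automata G A"
  shows "orbit_map A (value_at_one G A T) = T"
proof (rule extensionalityI)
  show "orbit_map A (value_at_one G A T) \<in> extensional (configs G A)"
    by (simp add: orbit_map_def)
  show "T \<in> extensional (configs G A)"
    using CA_PiE[OF assms] by (simp add: PiE_iff)
next
  fix x assume x: "x \<in> configs G A"
  obtain S \<mu> where T: "\<And>x g. \<lbrakk>x \<in> configs G A; g \<in> carrier G\<rbrakk>
      \<Longrightarrow> T x g = \<mu> (restrict (shift G (inv g) x) S)"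
    using assms unfolding cellular_automata_def by blast
  show "orbit_map A (value_at_one G A T) x = T x"
  proof (rule extensionalityI)
    show "T x \<in> extensional (carrier G)"
      using CA_PiE[OF assms] x unfolding configs_def by (auto simp: PiE_iff)
    show "orbit_map A (value_at_one G A T) x \<in> extensional (carrier G)"
      using x by (simp add: orbit_map_def)
    show "orbit_map A (value_at_one G A T) x g = T x g" if "g \<in> carrier G" for g
      using x that shift_one[OF shift_in_configs[OF x]]
      by (simp add: orbit_map_apply value_at_one_def shift_in_configs T)
  qed
qed


section \<open>Closure and the monoid laws\<close>

lemma UC_mult_closed:
  assumes f1: "f1 \<in> UC_functions G A" and f2: "f2 \<in> UC_functions G A"
  shows "UC_mult G A f1 f2 \<in> UC_functions G A"
proof -
  obtain \<Omega>1 where \<Omega>1: "finite \<Omega>1" "\<Omega>1 \<subseteq> carrier G"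
    and dep1: "\<And>x y. \<lbrakk>x \<in> configs G A; y \<in> configs G A; restrict x \<Omega>1 = restrict y \<Omega>1\<rbrakk>
      \<Longrightarrow> f1 x = f1 y"
    using UC_functionsE[OF f1] by blast
  obtain \<Omega>2 where \<Omega>2: "finite \<Omega>2" "\<Omega>2 \<subseteq> carrier G"
    and dep2: "\<And>x y. \<lbrakk>x \<in> configs G A; y \<in> configs G A; restrict x \<Omega>2 = restrict y \<Omega>2\<rbrakk>
      \<Longrightarrow> f2 x = f2 y"
    using UC_functionsE[OF f2] by blast
  have orbit2: "orbit_map A f2 x \<in> configs G A" if "x \<in> configs G A" for x
    using that UC_functions_PiE[OF f2] by (auto intro: orbit_map_in_configs)
  have maps: "UC_mult G A f1 f2 \<in> configs G A \<rightarrow>\<^sub>E A"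
  proof (rule PiE_I)
    show "UC_mult G A f1 f2 x \<in> A" if "x \<in> configs G A" for x
      using that orbit2 UC_functions_PiE[OF f1] by (auto simp: UC_mult_apply)
  qed (simp add: UC_mult_def)
  show ?thesis
  proof (rule UC_functionsI[OF maps])
    let ?\<Omega> = "(\<lambda>(g, s). g \<otimes> s) ` (\<Omega>1 \<times> \<Omega>2)"
    show "finite ?\<Omega>" using \<Omega>1(1) \<Omega>2(1) by simp
    show "?\<Omega> \<subseteq> carrier G" using \<Omega>1(2) \<Omega>2(2) by auto
    fix x y
    assume x: "x \<in> configs G A" and y: "y \<in> configs G A" and eq: "restrict x ?\<Omega> = restrict y ?\<Omega>"
    have "orbit_map A f2 x g = orbit_map A f2 y g" if g: "g \<in> \<Omega>1" for g
    proof -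
      have gG: "g \<in> carrier G" using g \<Omega>1(2) by blast
      have "x (g \<otimes> s) = y (g \<otimes> s)" if "s \<in> \<Omega>2" for s
        using eq g that by (auto simp: restrict_eq_iff)
      then have "restrict (shift G (inv g) x) \<Omega>2 = restrict (shift G (inv g) y) \<Omega>2"
        using \<Omega>2(2) gG by (auto simp: restrict_eq_iff shift_inv_apply subset_iff)
      then show ?thesis
        using x y gG by (auto simp: orbit_map_apply shift_in_configs intro: dep2)
    qed
    then show "UC_mult G A f1 f2 x = UC_mult G A f1 f2 y"
      using x y by (auto simp: UC_mult_apply orbit2 restrict_eq_iff intro: dep1)
  qed
qed

lemma UC_one_closed: "(\<lambda>x\<in>configs G A. x \<one>) \<in> UC_functions G A"
proof (rule UC_functionsI)
  show "(\<lambda>x\<in>configs G A. x \<one>) \<in> configs G A \<rightarrow>\<^sub>E A"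
    by (auto simp: configs_def)
  show "finite {\<one>}" "{\<one>} \<subseteq> carrier G" by auto
qed (simp add: restrict_eq_iff)

lemma orbit_map_UC_one: "orbit_map A (\<lambda>x\<in>configs G A. x \<one>) = (\<lambda>x\<in>configs G A. x)"
proof -
  have "(\<lambda>g\<in>carrier G. shift G (inv g) x \<one>) = x" if "x \<in> configs G A" for x
    using that by (auto simp: shift_inv_apply configs_def PiE_iff extensional_def)
  then show ?thesis
    by (auto simp: orbit_map_def shift_in_configs cong: restrict_cong)
qed

lemma CA_one_closed:
  assumes "A \<noteq> {}"
  shows "(\<lambda>x\<in>configs G A. x) \<in> cellular_automata G A"
  using orbit_map_in_CA[OF UC_one_closed assms] by (simp add: orbit_map_UC_one)

lemma compose_eq_orbit_map:
  assumes "T1 \<in> cellular_automata G A" "T2 \<in> cellular_automata G A"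
  shows "compose (configs G A) T1 T2 =
    orbit_map A (UC_mult G A (value_at_one G A T1) (value_at_one G A T2))"
proof -
  have "value_at_one G A T2 \<in> configs G A \<rightarrow> A"
    using UC_functions_PiE[OF value_at_one_in_UC[OF assms(2)]] by auto
  from orbit_map_UC_mult[OF this] show ?thesis
    by (simp add: orbit_map_value_at_one assms)
qed

lemma CA_compose_closed:
  assumes "A \<noteq> {}" "T1 \<in> cellular_automata G A" "T2 \<in> cellular_automata G A"
  shows "compose (configs G A) T1 T2 \<in> cellular_automata G A"
  using assms
  by (simp add: compose_eq_orbit_map orbit_map_in_CA UC_mult_closed value_at_one_in_UC)

lemma value_at_one_compose:
  assumes "T1 \<in> cellular_automata G A" "T2 \<in> cellular_automata G A"
  shows "value_at_one G A (compose (configs G A) T1 T2) =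
    UC_mult G A (value_at_one G A T1) (value_at_one G A T2)"
  using assms
  by (simp add: compose_eq_orbit_map value_at_one_orbit_map UC_functions_PiE UC_mult_closed
      value_at_one_in_UC)

lemma monoid_CA:
  assumes "A \<noteq> {}"
  shows "monoid (CA_monoid G A)"
proof (rule monoidI, unfold CA_monoid_def monoid.simps partial_object.simps)
  fix T1 T2 T3
  assume T: "T1 \<in> cellular_automata G A" "T2 \<in> cellular_automata G A"
    "T3 \<in> cellular_automata G A"
  show "compose (configs G A) T1 T2 \<in> cellular_automata G A"
    by (rule CA_compose_closed[OF assms T(1,2)])
  show "compose (configs G A) (compose (configs G A) T1 T2) T3 =
      compose (configs G A) T1 (compose (configs G A) T2 T3)"
    using CA_PiE[OF T(3)] by (intro compose_assoc[symmetric]) auto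
next
  fix T assume T: "T \<in> cellular_automata G A"
  have "T \<in> configs G A \<rightarrow> configs G A" "T \<in> extensional (configs G A)"
    using CA_PiE[OF T] by (auto simp: PiE_iff)
  then show "compose (configs G A) (\<lambda>x\<in>configs G A. x) T = T"
    "compose (configs G A) T (\<lambda>x\<in>configs G A. x) = T"
    by (rule Id_compose compose_Id; assumption)+
qed (rule CA_one_closed[OF assms])

lemma value_at_one_iso:
  assumes "A \<noteq> {}"
  shows "value_at_one G A \<in> iso (CA_monoid G A) (UC_monoid G A)"
proof -
  have "bij_betw (value_at_one G A) (cellular_automata G A) (UC_functions G A)"
    by (rule bij_betw_byWitness[where f' = "orbit_map A"])
      (auto simp: orbit_map_value_at_one value_at_one_orbit_map UC_functions_PiE
        value_at_one_in_UC orbit_map_in_CA assms)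
  then show ?thesis
    by (auto simp: iso_def hom_def CA_monoid_def UC_monoid_def value_at_one_in_UC
        value_at_one_compose)
qed

lemma value_at_one_one: "value_at_one G A \<one>\<^bsub>CA_monoid G A\<^esub> = \<one>\<^bsub>UC_monoid G A\<^esub>"
  by (auto simp: value_at_one_def CA_monoid_def UC_monoid_def)

lemma monoid_UC:
  assumes "A \<noteq> {}"
  shows "monoid (UC_monoid G A)"
proof -
  interpret CA: monoid "CA_monoid G A" using monoid_CA[OF assms] .
  \<comment> \<open>The image of a monoid under a homomorphism is a monoid, and here the image is everything.\<close>
  have "monoid (UC_monoid G A \<lparr>carrier := value_at_one G A ` carrier (CA_monoid G A),
      one := value_at_one G A \<one>\<^bsub>CA_monoid G A\<^esub>\<rparr>)"
    using value_at_one_iso[OF assms] by (intro CA.hom_imp_img_monoid) (simp add: iso_def)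
  moreover have "value_at_one G A ` carrier (CA_monoid G A) = carrier (UC_monoid G A)"
    using value_at_one_iso[OF assms] by (simp add: iso_def bij_betw_def)
  ultimately show ?thesis by (simp add: value_at_one_one)
qed

end

theorem theoremA:
  fixes G :: "('g, 'm) monoid_scheme" and A :: "'a set"
  assumes "group G" and "A \<noteq> {}"
  shows "monoid (CA_monoid G A) \<and> monoid (UC_monoid G A) \<and>
    value_at_one G A \<in> iso (CA_monoid G A) (UC_monoid G A) \<and>
    value_at_one G A \<one>\<^bsub>CA_monoid G A\<^esub> = \<one>\<^bsub>UC_monoid G A\<^esub>"
proof -
  interpret group G by fact
  show ?thesis
    using assms(2) by (intro conjI monoid_CA monoid_UC value_at_one_iso value_at_one_one)
qed

end
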